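(* For every integer $d\ge 1$, the $d$-dimensional infinite grid $G_{d;\infty}$ on the vertex set $\mathbb{Z}^d$ satisfies $\chi\bigl((G_{d;\infty})^2\bigr)=2d+1$.
   Context: $G_{d;\infty}=P_\infty\,\Box\cdots\Box\,P_\infty$ ($d$ factors, Cartesian product) is the graph with vertex set $\mathbb{Z}^d$ in which two vertices are adjacent iff they differ in exactly one coordinate, and there by exactly $1$. The square $G^2$ of a graph $G$ has the same vertex set, with two distinct vertices adjacent iff they are at distance at most $2$ in $G$. $\chi$ denotes the chromatic number. *)

theory Defs
  imports "HOL-Library.Extended_Nat" "HOL-Library.FuncSet"
begin

text \<open>Simple undirected graphs, possibly infinite, with the adjacency relation as edge set.\<close>

record 'a graph =
  verts :: "'a set"
  edges :: "'a rel"

definition simple_graph :: "'a graph \<Rightarrow> bool" where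
  "simple_graph G \<longleftrightarrow> edges G \<subseteq> verts G \<times> verts G \<and> sym (edges G) \<and> irrefl (edges G)"

text \<open>The relational power \<open>edges G ^^ n\<close> relates the end points of walks of length \<open>n\<close>;
  vertices in different components are at distance \<open>\<infinity>\<close>.\<close>

definition graph_dist :: "'a graph \<Rightarrow> 'a \<Rightarrow> 'a \<Rightarrow> enat" where
  "graph_dist G u v = Inf {enat n | n. (u, v) \<in> edges G ^^ n}"

definition graph_square :: "'a graph \<Rightarrow> 'a graph" where
  "graph_square G =
     \<lparr>verts = verts G,
      edges = {(u, v). u \<in> verts G \<and> v \<in> verts G \<and> u \<noteq> v \<and> graph_dist G u v \<le> 2}\<rparr>"

definition proper_coloring :: "'a graph \<Rightarrow> nat \<Rightarrow> ('a \<Rightarrow> nat) \<Rightarrow> bool" where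
  "proper_coloring G k c \<longleftrightarrow>
     (\<forall>v \<in> verts G. c v < k) \<and> (\<forall>(u, v) \<in> edges G. c u \<noteq> c v)"

text \<open>The value is \<open>\<infinity>\<close> if no finite number of colours suffices.\<close>

definition chromatic_number :: "'a graph \<Rightarrow> enat" where
  "chromatic_number G = Inf {enat k | k. \<exists>c. proper_coloring G k c}"

definition infinite_path :: "int graph" where
  "infinite_path = \<lparr>verts = UNIV, edges = {(x, y). \<bar>x - y\<bar> = 1}\<rparr>"

text \<open>The vertices of the product are the extensional functions on the index set, so that
  for \<open>I = {..<d}\<close> they correspond to \<open>d\<close>-tuples.\<close>

definition cartesian_product :: "'i set \<Rightarrow> ('i \<Rightarrow> 'a graph) \<Rightarrow> ('i \<Rightarrow> 'a) graph" where
  "cartesian_product I G =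
     \<lparr>verts = (\<Pi>\<^sub>E i\<in>I. verts (G i)),
      edges = {(x, y). x \<in> (\<Pi>\<^sub>E i\<in>I. verts (G i)) \<and> y \<in> (\<Pi>\<^sub>E i\<in>I. verts (G i)) \<and>
                 (\<exists>i\<in>I. (x i, y i) \<in> edges (G i) \<and> (\<forall>j\<in>I - {i}. x j = y j))}\<rparr>"

definition infinite_grid :: "nat \<Rightarrow> (nat \<Rightarrow> int) graph" where
  "infinite_grid d = cartesian_product {..<d} (\<lambda>_. infinite_path)"

lemma verts_infinite_grid: "verts (infinite_grid d) = ({..<d} \<rightarrow>\<^sub>E UNIV)"
  by (simp add: infinite_grid_def cartesian_product_def infinite_path_def)

lemma edges_infinite_grid_iff:
  "(x, y) \<in> edges (infinite_grid d) \<longleftrightarrow>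
     x \<in> verts (infinite_grid d) \<and> y \<in> verts (infinite_grid d) \<and>
     (\<exists>i<d. \<bar>x i - y i\<bar> = 1 \<and> (\<forall>j<d. j \<noteq> i \<longrightarrow> x j = y j))"
  by (auto simp: infinite_grid_def cartesian_product_def infinite_path_def)

lemma simple_graph_infinite_grid: "simple_graph (infinite_grid d)"
  unfolding simple_graph_def
  by (auto simp: edges_infinite_grid_iff irrefl_def abs_minus_commute intro!: symI) metis

lemma simple_graph_graph_square:
  assumes "simple_graph G"
  shows "simple_graph (graph_square G)"
proof -
  have sym: "sym (edges G)"
    using assms by (simp add: simple_graph_def)
  have step: "(v, u) \<in> edges G ^^ n" if "(u, v) \<in> edges G ^^ n" for u v n
    using that
  proof (induction n arbitrary: v)
    case (Suc n)
    then show ?case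
      by (metis relpow_Suc_E relpow_Suc_I2 sym symE)
  qed simp
  have "(u, v) \<in> edges G ^^ n \<longleftrightarrow> (v, u) \<in> edges G ^^ n" for u v n
    using step by blast
  then show ?thesis
    by (auto simp: simple_graph_def graph_square_def graph_dist_def irrefl_def intro!: symI)
qed

end

theory Submission
  imports Defs
begin

text \<open>For the upper bound, colour \<open>x\<close> by the residue of \<open>f x = (\<Sum>i<d. (i + 1) * x i)\<close> modulo
  \<open>2 d + 1\<close>. A step along coordinate \<open>i\<close> changes \<open>f\<close> by \<open>\<plusminus>(i + 1)\<close>, so a walk of one or two
  steps changes it by at most \<open>2 d\<close> in absolute value. The residue is therefore preserved only if
  \<open>f\<close> itself is; since the weights \<open>1, \<dots>, d\<close> are nonzero and distinct, this requires two steps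
  that cancel, and then the walk is closed. For the lower bound, a vertex and its \<open>2 d\<close>
  neighbours are pairwise at distance at most two, hence need different colours.\<close>

section \<open>Squares of graphs and their colourings\<close>

lemma graph_dist_le_iff:
  "graph_dist G u v \<le> enat n \<longleftrightarrow> (\<exists>m\<le>n. (u, v) \<in> edges G ^^ m)"
proof
  let ?A = "{enat n | n. (u, v) \<in> edges G ^^ n}"
  assume le: "graph_dist G u v \<le> enat n"
  then have "?A \<noteq> {}"
    by (auto simp: graph_dist_def Inf_enat_def split: if_splits)
  then have "Inf ?A \<in> ?A"
    unfolding Inf_enat_def by (auto intro: LeastI)
  then obtain m where "Inf ?A = enat m" "(u, v) \<in> edges G ^^ m"
    by blast
  with le show "\<exists>m\<le>n. (u, v) \<in> edges G ^^ m"
    by (auto simp: graph_dist_def)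
next
  assume "\<exists>m\<le>n. (u, v) \<in> edges G ^^ m"
  then obtain m where m: "m \<le> n" "(u, v) \<in> edges G ^^ m"
    by blast
  then have "graph_dist G u v \<le> enat m"
    unfolding graph_dist_def by (intro Inf_lower) blast
  with m show "graph_dist G u v \<le> enat n"
    by (meson enat_ord_simps(1) order_trans)
qed

lemma edges_graph_square_iff:
  "(u, v) \<in> edges (graph_square G) \<longleftrightarrow>
     u \<in> verts G \<and> v \<in> verts G \<and> u \<noteq> v \<and>
     ((u, v) \<in> edges G \<or> (\<exists>w. (u, w) \<in> edges G \<and> (w, v) \<in> edges G))"
proof -
  have "(\<exists>m\<le>2. (u, v) \<in> edges G ^^ m) \<longleftrightarrow>
      u = v \<or> (u, v) \<in> edges G \<or> (u, v) \<in> edges G O edges G"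
    by (simp add: numeral_2_eq_2 le_Suc_eq conj_disj_distribR ex_disj_distrib)
  then show ?thesis
    using graph_dist_le_iff[of G u v 2] by (auto simp: graph_square_def numeral_eq_enat)
qed

lemma card_clique_le_colors:
  assumes "proper_coloring G k c" "K \<subseteq> verts G"
    and "\<And>u v. u \<in> K \<Longrightarrow> v \<in> K \<Longrightarrow> u \<noteq> v \<Longrightarrow> (u, v) \<in> edges G"
  shows "card K \<le> k"
proof -
  have "inj_on c K"
    using assms(1,3) by (fastforce simp: inj_on_def proper_coloring_def)
  moreover have "c ` K \<subseteq> {..<k}"
    using assms(1,2) by (auto simp: proper_coloring_def)
  ultimately have "card K \<le> card {..<k}"
    by (intro card_inj_on_le) auto
  then show ?thesis
    by simp
qed

lemma closed_neighbourhood_clique_square: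
  assumes "simple_graph G"
    and "u \<in> insert v (edges G `` {v})" "w \<in> insert v (edges G `` {v})" "u \<noteq> w"
  shows "(u, w) \<in> edges (graph_square G)"
  using assms
  by (auto simp: edges_graph_square_iff simple_graph_def dest: symD)

section \<open>A colouring of the square of the grid\<close>

text \<open>The linear form whose residue modulo \<open>2 d + 1\<close> is the colour. Coordinates are numbered
  from \<open>0\<close>, so coordinate \<open>i\<close> gets weight \<open>i + 1\<close>.\<close>

definition weighted_sum :: "nat \<Rightarrow> (nat \<Rightarrow> int) \<Rightarrow> int" where
  "weighted_sum d x = (\<Sum>i<d. (int i + 1) * x i)"

lemma weighted_sum_upd:
  assumes "i < d"
  shows "weighted_sum d (x(i := x i + s)) = weighted_sum d x + (int i + 1) * s"
proof -
  have "weighted_sum d (x(i := x i + s))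
      = (\<Sum>j<d. (int j + 1) * x j + (if j = i then (int i + 1) * s else 0))"
    unfolding weighted_sum_def by (intro sum.cong) (auto simp: algebra_simps)
  then show ?thesis
    using assms by (simp add: sum.distrib weighted_sum_def)
qed

lemma infinite_grid_edgeE:
  assumes "(x, y) \<in> edges (infinite_grid d)"
  obtains i s where "i < d" "s = 1 \<or> s = -1" "y = x(i := x i + s)"
proof -
  from assms obtain i where i: "i < d" "\<bar>x i - y i\<bar> = 1" "\<forall>j<d. j \<noteq> i \<longrightarrow> x j = y j"
    and "x \<in> {..<d} \<rightarrow>\<^sub>E UNIV" "y \<in> {..<d} \<rightarrow>\<^sub>E UNIV"
    by (auto simp: edges_infinite_grid_iff verts_infinite_grid)
  then have "y j = (x(i := x i + (y i - x i))) j" for j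
    by (cases "j < d") (auto simp: PiE_def extensional_def)
  then have "y = x(i := x i + (y i - x i))" ..
  with i show thesis
    by (intro that[of i "y i - x i"]) auto
qed

lemma infinite_grid_edgeI:
  assumes "x \<in> verts (infinite_grid d)" "i < d" "\<bar>s\<bar> = 1"
  shows "(x, x(i := x i + s)) \<in> edges (infinite_grid d)"
  using assms by (auto simp: edges_infinite_grid_iff verts_infinite_grid PiE_def extensional_def)

lemma weighted_sum_mod_neq:
  assumes "(x, y) \<in> edges (graph_square (infinite_grid d))"
  shows "weighted_sum d x mod (2 * int d + 1) \<noteq> weighted_sum d y mod (2 * int d + 1)"
proof
  let ?m = "2 * int d + 1"
  assume "weighted_sum d x mod ?m = weighted_sum d y mod ?m"
  then have dvd: "?m dvd weighted_sum d y - weighted_sum d x"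
    by (metis mod_eq_dvd_iff)
  have eq_0: "t = 0" if "?m dvd t" "\<bar>t\<bar> \<le> 2 * int d" for t
    using that zdvd_not_zless[of "\<bar>t\<bar>" ?m] by fastforce
  have "x \<noteq> y"
    using assms by (simp add: edges_graph_square_iff)
  from assms consider "(x, y) \<in> edges (infinite_grid d)"
    | w where "(x, w) \<in> edges (infinite_grid d)" "(w, y) \<in> edges (infinite_grid d)"
    by (auto simp: edges_graph_square_iff)
  then show False
  proof cases
    case 1
    then obtain i s where "i < d" and s: "s = 1 \<or> s = -1" and y: "y = x(i := x i + s)"
      by (rule infinite_grid_edgeE)
    then have "weighted_sum d y - weighted_sum d x = (int i + 1) * s"
      by (simp add: weighted_sum_upd)
    with dvd eq_0[of "(int i + 1) * s"] \<open>i < d\<close> s show False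
      by auto
  next
    case 2
    obtain i s where i: "i < d" and s: "s = 1 \<or> s = -1" and w: "w = x(i := x i + s)"
      using 2(1) by (rule infinite_grid_edgeE)
    obtain j t where j: "j < d" and t: "t = 1 \<or> t = -1" and y: "y = w(j := w j + t)"
      using 2(2) by (rule infinite_grid_edgeE)
    have "weighted_sum d y - weighted_sum d x = (int i + 1) * s + (int j + 1) * t"
      unfolding y weighted_sum_upd[OF j] unfolding w weighted_sum_upd[OF i] by simp
    with dvd eq_0[of "(int i + 1) * s + (int j + 1) * t"] i j s t
    have "(int i + 1) * s + (int j + 1) * t = 0"
      by auto
    then have "i = j \<and> t = - s"
      using s t by auto
    then have "y = x"
      by (simp add: y w)
    with \<open>x \<noteq> y\<close> show False
      by simp
  qed
qed

lemma proper_coloring_square_grid: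
  "proper_coloring (graph_square (infinite_grid d)) (2 * d + 1)
     (\<lambda>x. nat (weighted_sum d x mod (2 * int d + 1)))"
  unfolding proper_coloring_def
proof (intro conjI ballI)
  fix x
  have "weighted_sum d x mod (2 * int d + 1) < 2 * int d + 1"
    by (rule pos_mod_bound) simp
  then show "nat (weighted_sum d x mod (2 * int d + 1)) < 2 * d + 1"
    by linarith
qed (use weighted_sum_mod_neq in \<open>auto simp: nat_eq_iff\<close>)

section \<open>A clique in the square of the grid\<close>

text \<open>The clique is the closed neighbourhood of the origin: the origin itself and the \<open>2 d\<close>
  unit vectors \<open>\<plusminus>e\<^sub>i\<close>.\<close>

lemma square_grid_clique:
  obtains K where "card K = 2 * d + 1" "K \<subseteq> verts (infinite_grid d)"
    "\<And>u v. u \<in> K \<Longrightarrow> v \<in> K \<Longrightarrow> u \<noteq> v \<Longrightarrow> (u, v) \<in> edges (graph_square (infinite_grid d))"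
proof -
  define x :: "nat \<Rightarrow> int" where "x = (\<lambda>i\<in>{..<d}. 0)"
  define e where "e = (\<lambda>(i, s). x(i := x i + s))"
  define N where "N = e ` ({..<d} \<times> {1, -1})"
  have x: "x \<in> verts (infinite_grid d)"
    by (simp add: x_def verts_infinite_grid)
  have N: "N \<subseteq> edges (infinite_grid d) `` {x}"
    using infinite_grid_edgeI[OF x, of _ 1] infinite_grid_edgeI[OF x, of _ "-1"]
    by (auto simp: N_def e_def)
  have "x \<notin> N"
    using N simple_graph_infinite_grid[of d] by (auto simp: simple_graph_def irrefl_def)
  have "inj_on e ({..<d} \<times> {1, -1})"
  proof (rule inj_onI, clarify)
    fix i j s t
    assume s: "s \<in> {1, -1}" and t: "t \<in> {1, -1}" and "e (i, s) = e (j, t)"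
    then have eq: "(x(i := x i + s)) k = (x(j := x j + t)) k" for k
      by (simp add: e_def)
    \<comment> \<open>Coordinate \<open>i\<close> differs from \<open>x i\<close> on the left, hence also on the right.\<close>
    show "i = j \<and> s = t"
      using eq[of i] s by (auto split: if_splits)
  qed
  then have "card N = 2 * d"
    by (simp add: N_def card_image)
  moreover have "finite N"
    by (simp add: N_def)
  ultimately have "card (insert x N) = 2 * d + 1"
    using \<open>x \<notin> N\<close> by simp
  moreover have "insert x N \<subseteq> verts (infinite_grid d)"
    using x N by (auto simp: edges_infinite_grid_iff)
  moreover have "(u, v) \<in> edges (graph_square (infinite_grid d))"
    if "u \<in> insert x N" "v \<in> insert x N" "u \<noteq> v" for u v
    using closed_neighbourhood_clique_square[OF simple_graph_infinite_grid, of u x d v] that N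
    by blast
  ultimately show thesis
    by (rule that)
qed

section \<open>The chromatic number\<close>

theorem proposition13:
  fixes d :: nat
  assumes "d \<ge> 1"
  shows "chromatic_number (graph_square (infinite_grid d)) = enat (2 * d + 1)"
proof (rule antisym)
  show "chromatic_number (graph_square (infinite_grid d)) \<le> enat (2 * d + 1)"
    unfolding chromatic_number_def
    using proper_coloring_square_grid[of d] by (intro Inf_lower) blast
  obtain K where K: "card K = 2 * d + 1" "K \<subseteq> verts (infinite_grid d)"
    "\<And>u v. u \<in> K \<Longrightarrow> v \<in> K \<Longrightarrow> u \<noteq> v \<Longrightarrow> (u, v) \<in> edges (graph_square (infinite_grid d))"
    using square_grid_clique[of d] by metis
  have "2 * d + 1 \<le> k" if "proper_coloring (graph_square (infinite_grid d)) k c" for k c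
    using card_clique_le_colors[OF that, of K] K by (simp add: graph_square_def)
  then show "enat (2 * d + 1) \<le> chromatic_number (graph_square (infinite_grid d))"
    unfolding chromatic_number_def by (intro Inf_greatest) auto
qed

end
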